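(* Consider the set of $F$-manifolds $(M,\circ,e,\mathcal{E},\tilde{\nabla})$ with an eventual identity $\mathcal{E}$ and a compatible, torsion-free connection $\tilde{\nabla}$ satisfying $$\tilde{\nabla}_{X}(e)=\frac{1}{2}[\mathcal{E}^{-1},\mathcal{E}]\circ X,\qquad\forall X\in\mathcal{X}(M).$$ The map $$(M,\circ,e,\mathcal{E},\tilde{\nabla})\rightarrow(M,*,\mathcal{E},e,\nabla^{\mathcal{F}}),$$ where $X*Y:=X\circ Y\circ\mathcal{E}^{-1}$ and $\nabla^{\mathcal{F}}$ is the second structure connection of $(M,\circ,e,\mathcal{E},\tilde{\nabla})$, i.e. $$\nabla^{\mathcal{F}}_{X}(Y):=\mathcal{E}\circ\tilde{\nabla}_{X}(\mathcal{E}^{-1}\circ Y)-\tilde{\nabla}_{\mathcal{E}^{-1}\circ Y}(\mathcal{E})\circ X,$$ is an involution on this set.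
   Context: Everything is in the smooth category; $\mathcal{X}(M)$ denotes the vector fields on the manifold $M$. $F$-manifold: a triple $(M,\circ,e)$ where $M$ is a manifold and $\circ$ is a fiber-preserving commutative, associative, bilinear multiplication on $TM$ with unit field $e$, such that $L_{X\circ Y}(\circ)=X\circ L_{Y}(\circ)+Y\circ L_{X}(\circ)$ for all $X,Y\in\mathcal{X}(M)$, where $L_{Z}(\circ)(X,Y)=[Z,X\circ Y]-[Z,X]\circ Y-X\circ[Z,Y]$. Invertible vector field: $\mathcal{E}$ is invertible if there is a vector field $\mathcal{E}^{-1}$ with $\mathcal{E}\circ\mathcal{E}^{-1}=e$. Eventual identity on an $F$-manifold $(M,\circ,e)$: an invertible vector field $\mathcal{E}$ such that the multiplication $X*Y:=X\circ Y\circ\mathcal{E}^{-1}$ (whose unit field is $\mathcal{E}$) defines an $F$-manifold $(M,*,\mathcal{E})$. It is known that then $e$ is an eventual identity on $(M,*,\mathcal{E})$ and that $(M,\circ,e,\mathcal{E})\mapsto(M,*,\mathcal{E},e)$ is an involution on the set of $F$-manifolds with eventual identities. When the condition on the connection is applied to $(M,*,\mathcal{E},e,\nabla^{\mathcal{F}})$, the multiplication is $*$, the unit field is $\mathcal{E}$, the eventual identity is $e$, and inverses are taken with respect to $*$. Compatible connection: a connection $\nabla$ on $TM$ is compatible with a commutative, associative multiplication $\circ$ on $TM$ if $\nabla_{X}(\circ)(Y,Z):=\nabla_{X}(Y\circ Z)-\nabla_{X}(Y)\circ Z-Y\circ\nabla_{X}(Z)$ is totally symmetric in $X,Y,Z$.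 *)

theory Defs
  imports "HOL-Analysis.Analysis" "HOL-Library.Function_Algebras"
begin

section \<open>Smooth manifolds\<close>

text \<open>
  Points of \<open>Euclidean_space n\<close> are the functions \<open>x :: nat \<Rightarrow> real\<close> with \<open>x i = 0\<close> for
  \<open>i \<ge> n\<close>. This makes the dimension a number rather than a type, so that manifolds of all
  dimensions (including 0) live in one set.
\<close>

definition partial_deriv :: "nat \<Rightarrow> ((nat \<Rightarrow> real) \<Rightarrow> real) \<Rightarrow> (nat \<Rightarrow> real) \<Rightarrow> real" where
  "partial_deriv i f x = deriv (\<lambda>t. f (x(i := t))) (x i)"

text \<open>The set \<open>U\<close> is always an open subset of \<open>Euclidean_space n\<close> below.\<close>

primrec Ck_on :: "nat \<Rightarrow> nat \<Rightarrow> (nat \<Rightarrow> real) set \<Rightarrow> ((nat \<Rightarrow> real) \<Rightarrow> real) \<Rightarrow> bool" where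
  "Ck_on 0 n U f \<longleftrightarrow> continuous_map (subtopology (Euclidean_space n) U) euclideanreal f"
| "Ck_on (Suc k) n U f \<longleftrightarrow>
     continuous_map (subtopology (Euclidean_space n) U) euclideanreal f \<and>
     (\<forall>i<n. (\<forall>x\<in>U. (\<lambda>t. f (x(i := t))) differentiable (at (x i))) \<and>
            Ck_on k n U (partial_deriv i f))"

definition smooth_on :: "nat \<Rightarrow> (nat \<Rightarrow> real) set \<Rightarrow> ((nat \<Rightarrow> real) \<Rightarrow> real) \<Rightarrow> bool" where
  "smooth_on n U f \<longleftrightarrow> (\<forall>k. Ck_on k n U f)"

record 'a mfd =
  mtop :: "'a topology"
  mdim :: nat
  charts :: "('a set \<times> ('a \<Rightarrow> nat \<Rightarrow> real)) set"

abbreviation points :: "'a mfd \<Rightarrow> 'a set" where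
  "points M \<equiv> topspace (mtop M)"

definition smooth_manifold :: "'a mfd \<Rightarrow> bool" where
  "smooth_manifold M \<longleftrightarrow>
     Hausdorff_space (mtop M) \<and> second_countable (mtop M) \<and>
     (\<Union>(U, \<phi>)\<in>charts M. U) = points M \<and>
     (\<forall>(U, \<phi>)\<in>charts M.
        openin (mtop M) U \<and> openin (Euclidean_space (mdim M)) (\<phi> ` U) \<and>
        homeomorphic_map (subtopology (mtop M) U)
          (subtopology (Euclidean_space (mdim M)) (\<phi> ` U)) \<phi>) \<and>
     (\<forall>(U, \<phi>)\<in>charts M. \<forall>(V, \<psi>)\<in>charts M. \<forall>i<mdim M.
        smooth_on (mdim M) (\<phi> ` (U \<inter> V)) (\<lambda>x. \<psi> (inv_into U \<phi> x) i))"

definition smooth_functions :: "'a mfd \<Rightarrow> ('a \<Rightarrow> real) set" where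
  "smooth_functions M =
     {f. \<forall>(U, \<phi>)\<in>charts M. smooth_on (mdim M) (\<phi> ` U) (\<lambda>x. f (inv_into U \<phi> x))}"

section \<open>Tangent vectors, vector fields, Lie bracket\<close>

text \<open>
  A tangent vector at \<open>p\<close> is a derivation at \<open>p\<close> of the algebra of smooth functions. The values
  of a smooth function outside \<open>points M\<close> are unconstrained, but the Leibniz rule already forces
  derivations to ignore them. Throughout, maps are normalised to be 0 outside their domain, so
  that equality in HOL is equality of the mathematical objects. Addition, subtraction, 0 and
  multiplication of functions are pointwise.
\<close>

type_synonym 'a tvec = "('a \<Rightarrow> real) \<Rightarrow> real"
type_synonym 'a vfield = "'a \<Rightarrow> 'a tvec"

definition tscale :: "real \<Rightarrow> 'a tvec \<Rightarrow> 'a tvec" where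
  "tscale c v = (\<lambda>f. c * v f)"

definition tangent_space :: "'a mfd \<Rightarrow> 'a \<Rightarrow> 'a tvec set" where
  "tangent_space M p =
     {v. (\<forall>f\<in>smooth_functions M. \<forall>g\<in>smooth_functions M.
            v (f + g) = v f + v g \<and> v (f * g) = f p * v g + g p * v f) \<and>
         (\<forall>c. \<forall>f\<in>smooth_functions M. v (\<lambda>q. c * f q) = c * v f) \<and>
         (\<forall>f. f \<notin> smooth_functions M \<longrightarrow> v f = 0)}"

definition vector_fields :: "'a mfd \<Rightarrow> 'a vfield set" where
  "vector_fields M =
     {X. (\<forall>p\<in>points M. X p \<in> tangent_space M p) \<and>
         (\<forall>f\<in>smooth_functions M. (\<lambda>p. X p f) \<in> smooth_functions M) \<and>
         (\<forall>p. p \<notin> points M \<longrightarrow> X p = 0)}"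

definition fscale :: "('a \<Rightarrow> real) \<Rightarrow> 'a vfield \<Rightarrow> 'a vfield" where
  "fscale f X = (\<lambda>p. tscale (f p) (X p))"

definition lie_bracket :: "'a vfield \<Rightarrow> 'a vfield \<Rightarrow> 'a vfield" where
  "lie_bracket X Y = (\<lambda>p f. X p (\<lambda>q. Y q f) - Y p (\<lambda>q. X q f))"

section \<open>Multiplications on the tangent bundle\<close>

type_synonym 'a tmult = "'a \<Rightarrow> 'a tvec \<Rightarrow> 'a tvec \<Rightarrow> 'a tvec"

definition vmult :: "'a vfield \<Rightarrow> 'a tmult \<Rightarrow> 'a vfield \<Rightarrow> 'a vfield"
    ("(_ \<odot>\<^bsub>_\<^esub> _)" [71, 0, 70] 70) where
  "X \<odot>\<^bsub>m\<^esub> Y = (\<lambda>p. m p (X p) (Y p))"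

text \<open>Smoothness of the multiplication: products of smooth vector fields are smooth.\<close>

definition comm_assoc_mult :: "'a mfd \<Rightarrow> 'a tmult \<Rightarrow> bool" where
  "comm_assoc_mult M m \<longleftrightarrow>
     (\<forall>p\<in>points M. \<forall>u\<in>tangent_space M p. \<forall>v\<in>tangent_space M p.
        m p u v \<in> tangent_space M p \<and> m p u v = m p v u \<and>
        (\<forall>c. m p (tscale c u) v = tscale c (m p u v)) \<and>
        (\<forall>c. m p u (tscale c v) = tscale c (m p u v)) \<and>
        (\<forall>w\<in>tangent_space M p.
           m p (u + v) w = m p u w + m p v w \<and>
           m p w (u + v) = m p w u + m p w v \<and>
           m p (m p u v) w = m p u (m p v w))) \<and>
     (\<forall>X\<in>vector_fields M. \<forall>Y\<in>vector_fields M. X \<odot>\<^bsub>m\<^esub> Y \<in> vector_fields M) \<and>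
     (\<forall>p u v. p \<notin> points M \<or> u \<notin> tangent_space M p \<or> v \<notin> tangent_space M p \<longrightarrow> m p u v = 0)"

definition unit_field :: "'a mfd \<Rightarrow> 'a tmult \<Rightarrow> 'a vfield \<Rightarrow> bool" where
  "unit_field M m e \<longleftrightarrow> e \<in> vector_fields M \<and>
     (\<forall>p\<in>points M. \<forall>v\<in>tangent_space M p. m p (e p) v = v \<and> m p v (e p) = v)"

section \<open>F-manifolds and eventual identities\<close>

definition lie_deriv_mult :: "'a tmult \<Rightarrow> 'a vfield \<Rightarrow> 'a vfield \<Rightarrow> 'a vfield \<Rightarrow> 'a vfield" where
  "lie_deriv_mult m Z X Y =
     lie_bracket Z (X \<odot>\<^bsub>m\<^esub> Y) - lie_bracket Z X \<odot>\<^bsub>m\<^esub> Y - X \<odot>\<^bsub>m\<^esub> lie_bracket Z Y"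

definition F_manifold :: "'a mfd \<Rightarrow> 'a tmult \<Rightarrow> 'a vfield \<Rightarrow> bool" where
  "F_manifold M m e \<longleftrightarrow>
     smooth_manifold M \<and> comm_assoc_mult M m \<and> unit_field M m e \<and>
     (\<forall>X\<in>vector_fields M. \<forall>Y\<in>vector_fields M. \<forall>Z\<in>vector_fields M. \<forall>W\<in>vector_fields M.
        lie_deriv_mult m (X \<odot>\<^bsub>m\<^esub> Y) Z W =
          X \<odot>\<^bsub>m\<^esub> lie_deriv_mult m Y Z W + Y \<odot>\<^bsub>m\<^esub> lie_deriv_mult m X Z W)"

definition invertible_field :: "'a mfd \<Rightarrow> 'a tmult \<Rightarrow> 'a vfield \<Rightarrow> 'a vfield \<Rightarrow> bool" where
  "invertible_field M m e E \<longleftrightarrow>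
     E \<in> vector_fields M \<and> (\<exists>Z\<in>vector_fields M. E \<odot>\<^bsub>m\<^esub> Z = e)"

text \<open>Only meaningful for invertible \<open>E\<close>, in which case the inverse is unique.\<close>

definition field_inverse :: "'a mfd \<Rightarrow> 'a tmult \<Rightarrow> 'a vfield \<Rightarrow> 'a vfield \<Rightarrow> 'a vfield" where
  "field_inverse M m e E = (THE Z. Z \<in> vector_fields M \<and> E \<odot>\<^bsub>m\<^esub> Z = e)"

definition dual_mult :: "'a mfd \<Rightarrow> 'a tmult \<Rightarrow> 'a vfield \<Rightarrow> 'a vfield \<Rightarrow> 'a tmult" where
  "dual_mult M m e E = (\<lambda>p v w. m p (m p v w) (field_inverse M m e E p))"

definition eventual_identity :: "'a mfd \<Rightarrow> 'a tmult \<Rightarrow> 'a vfield \<Rightarrow> 'a vfield \<Rightarrow> bool" where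
  "eventual_identity M m e E \<longleftrightarrow>
     invertible_field M m e E \<and> F_manifold M (dual_mult M m e E) E"

section \<open>Connections\<close>

type_synonym 'a conn = "'a vfield \<Rightarrow> 'a vfield \<Rightarrow> 'a vfield"

text \<open>\<open>D X Y\<close> is the covariant derivative of \<open>Y\<close> in the direction \<open>X\<close>.\<close>

definition connection :: "'a mfd \<Rightarrow> 'a conn \<Rightarrow> bool" where
  "connection M D \<longleftrightarrow>
     (\<forall>X\<in>vector_fields M. \<forall>Y\<in>vector_fields M. D X Y \<in> vector_fields M \<and>
        (\<forall>Z\<in>vector_fields M. D (X + Y) Z = D X Z + D Y Z \<and> D Z (X + Y) = D Z X + D Z Y) \<and>
        (\<forall>f\<in>smooth_functions M.
           D (fscale f X) Y = fscale f (D X Y) \<and>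
           D X (fscale f Y) = fscale (\<lambda>p. X p f) Y + fscale f (D X Y))) \<and>
     (\<forall>X Y. X \<notin> vector_fields M \<or> Y \<notin> vector_fields M \<longrightarrow> D X Y = 0)"

definition torsion_free :: "'a mfd \<Rightarrow> 'a conn \<Rightarrow> bool" where
  "torsion_free M D \<longleftrightarrow>
     (\<forall>X\<in>vector_fields M. \<forall>Y\<in>vector_fields M. D X Y - D Y X = lie_bracket X Y)"

definition cov_deriv_mult ::
    "'a tmult \<Rightarrow> 'a conn \<Rightarrow> 'a vfield \<Rightarrow> 'a vfield \<Rightarrow> 'a vfield \<Rightarrow> 'a vfield" where
  "cov_deriv_mult m D X Y Z = D X (Y \<odot>\<^bsub>m\<^esub> Z) - D X Y \<odot>\<^bsub>m\<^esub> Z - Y \<odot>\<^bsub>m\<^esub> D X Z"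

text \<open>The two transpositions generate all permutations of the three arguments.\<close>

definition compatible :: "'a mfd \<Rightarrow> 'a tmult \<Rightarrow> 'a conn \<Rightarrow> bool" where
  "compatible M m D \<longleftrightarrow>
     (\<forall>X\<in>vector_fields M. \<forall>Y\<in>vector_fields M. \<forall>Z\<in>vector_fields M.
        cov_deriv_mult m D X Y Z = cov_deriv_mult m D Y X Z \<and>
        cov_deriv_mult m D X Y Z = cov_deriv_mult m D X Z Y)"

definition second_structure_connection ::
    "'a mfd \<Rightarrow> 'a tmult \<Rightarrow> 'a vfield \<Rightarrow> 'a vfield \<Rightarrow> 'a conn \<Rightarrow> 'a conn" where
  "second_structure_connection M m e E D = (\<lambda>X Y.
     if X \<in> vector_fields M \<and> Y \<in> vector_fields M
     then E \<odot>\<^bsub>m\<^esub> D X (field_inverse M m e E \<odot>\<^bsub>m\<^esub> Y)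
            - D (field_inverse M m e E \<odot>\<^bsub>m\<^esub> Y) E \<odot>\<^bsub>m\<^esub> X
     else 0)"

type_synonym 'a F_data = "'a mfd \<times> 'a tmult \<times> 'a vfield \<times> 'a vfield \<times> 'a conn"

definition special_F_manifolds :: "'a F_data set" where
  "special_F_manifolds =
     {(M, m, e, E, D).
        F_manifold M m e \<and> eventual_identity M m e E \<and>
        connection M D \<and> compatible M m D \<and> torsion_free M D \<and>
        (\<forall>X\<in>vector_fields M.
           D X e = fscale (\<lambda>_. 1/2) (lie_bracket (field_inverse M m e E) E) \<odot>\<^bsub>m\<^esub> X)}"

definition duality_map :: "'a F_data \<Rightarrow> 'a F_data" where
  "duality_map = (\<lambda>(M, m, e, E, D).
     (M, dual_mult M m e E, E, e, second_structure_connection M m e E D))"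

end

theory Submission
  imports Defs
begin

text \<open>
  Vector fields form a commutative ring under \<open>\<circ>\<close>. Since \<open>E\<close> is the unit of the
  F-manifold \<open>(M, *, E)\<close>, \<open>L\<^sub>E(*) = 0\<close>; hence an eventual identity satisfies \<open>L\<^sub>E(\<circ>)(X, Y) = [e, E] \<circ> X \<circ> Y\<close>, whence
  \<open>[E\<^sup>-\<^sup>1, E] = 2 E\<^sup>-\<^sup>1 \<circ> [e, E]\<close> and the condition on the connection becomes
  \<open>D\<^sub>X e = E\<^sup>-\<^sup>1 \<circ> [e, E] \<circ> X\<close>. Everything then follows by ring calculations with the symmetric
  tensor \<open>S(X, Y, Z) = D\<^sub>X(\<circ>)(Y, Z)\<close>. The involution property on multiplications rests on the
  \<open>*\<close>-inverse of \<open>e\<close> being \<open>E \<circ> E\<close>.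
\<close>

section \<open>Smooth functions form an algebra\<close>

text \<open>Coordinate lines are continuous for the product topology, and for \<open>i < n\<close>
  they stay inside the Euclidean space. Partial derivatives at points of U therefore see only values
  on U.\<close>

lemma eventually_fun_upd_in_open:
  assumes "openin (Euclidean_space n) U" "x \<in> U" "i < n"
  shows "\<forall>\<^sub>F t in nhds (x i). x(i := t) \<in> U"
proof -
  obtain W where W: "open W" "U = W \<inter> {x. \<forall>i\<ge>n. x i = 0}"
    using assms(1) by (auto simp: Euclidean_space_def openin_subtopology euclidean_product_topology)
  have "continuous_on UNIV (\<lambda>t. x(i := t))"
  proof (rule continuous_on_coordinatewise_then_product)
    show "continuous_on UNIV (\<lambda>t. (x(i := t)) j)" for j
      by (cases "j = i") auto
  qed
  then have "open ((\<lambda>t. x(i := t)) -` W)"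
    using W(1) by (simp add: continuous_on_open_vimage)
  moreover have "x i \<in> (\<lambda>t. x(i := t)) -` W"
    using assms(2) W by simp
  ultimately have "\<forall>\<^sub>F t in nhds (x i). t \<in> (\<lambda>t. x(i := t)) -` W"
    by (rule eventually_nhds_in_open)
  then show ?thesis
    using assms(2,3) W(2) by (auto elim!: eventually_mono)
qed

lemma continuous_map_subtopology_cong:
  assumes "\<And>x. x \<in> U \<Longrightarrow> f x = g x"
  shows "continuous_map (subtopology X U) Y f \<longleftrightarrow> continuous_map (subtopology X U) Y g"
  using assms by (auto elim!: continuous_map_eq)

lemma differentiable_cong_open:
  assumes "openin (Euclidean_space n) U" "x \<in> U" "i < n" "\<And>x. x \<in> U \<Longrightarrow> f x = g x"
  shows "(\<lambda>t. f (x(i := t))) differentiable (at (x i)) \<longleftrightarrow>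
         (\<lambda>t. g (x(i := t))) differentiable (at (x i))" (is ?D)
    and "partial_deriv i f x = partial_deriv i g x" (is ?P)
proof -
  have ev: "\<forall>\<^sub>F t in nhds (x i). f (x(i := t)) = g (x(i := t))"
    using eventually_fun_upd_in_open[OF assms(1-3)] by eventually_elim (use assms(4) in auto)
  have "DERIV (\<lambda>t. f (x(i := t))) (x i) :> d \<longleftrightarrow> DERIV (\<lambda>t. g (x(i := t))) (x i) :> d" for d
    by (rule DERIV_cong_ev[OF refl ev refl])
  then show ?D
    by (simp add: real_differentiable_def)
  show ?P
    unfolding partial_deriv_def by (rule deriv_cong_ev[OF ev refl])
qed

text \<open>Lets a partial derivative be replaced by a formula that is valid only on U, as in the
  sum and product rules.\<close>

lemma Ck_on_cong:
  assumes "openin (Euclidean_space n) U" "\<And>x. x \<in> U \<Longrightarrow> f x = g x"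
  shows "Ck_on k n U f \<longleftrightarrow> Ck_on k n U g"
  using assms(2)
proof (induction k arbitrary: f g)
  case 0
  then show ?case
    by (simp add: continuous_map_subtopology_cong[of U f g])
next
  case (Suc k)
  have "Ck_on k n U (partial_deriv i f) \<longleftrightarrow> Ck_on k n U (partial_deriv i g)" if "i < n" for i
    using that by (intro Suc.IH differentiable_cong_open(2)[OF assms(1)]) (auto intro: Suc.prems)
  moreover have "(\<lambda>t. f (x(i := t))) differentiable (at (x i)) \<longleftrightarrow>
         (\<lambda>t. g (x(i := t))) differentiable (at (x i))" if "i < n" "x \<in> U" for i x
    using that by (intro differentiable_cong_open(1)[OF assms(1)]) (auto intro: Suc.prems)
  ultimately show ?case
    using continuous_map_subtopology_cong[of U f g] Suc.prems by simp
qed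

lemma Ck_on_SucD: "Ck_on (Suc k) n U f \<Longrightarrow> Ck_on k n U f"
  by (induction k arbitrary: f) auto

lemma partial_deriv_has_deriv:
  assumes "(\<lambda>t. f (x(i := t))) differentiable (at (x i))"
  shows "DERIV (\<lambda>t. f (x(i := t))) (x i) :> partial_deriv i f x"
  using assms unfolding partial_deriv_def
  by (simp add: DERIV_deriv_iff_real_differentiable)

lemma Ck_on_add:
  assumes "openin (Euclidean_space n) U" "Ck_on k n U f" "Ck_on k n U g"
  shows "Ck_on k n U (\<lambda>x. f x + g x)"
  using assms(2,3)
proof (induction k arbitrary: f g)
  case 0
  then show ?case by (simp add: continuous_map_add)
next
  case (Suc k)
  have "Ck_on k n U (partial_deriv i (\<lambda>x. f x + g x))" if "i < n" for i
  proof -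
    have "partial_deriv i (\<lambda>x. f x + g x) x = partial_deriv i f x + partial_deriv i g x" if "x \<in> U" for x
      unfolding partial_deriv_def[of i "\<lambda>x. f x + g x"]
      using that \<open>i < n\<close> Suc.prems
      by (intro DERIV_imp_deriv DERIV_add partial_deriv_has_deriv) auto
    moreover have "Ck_on k n U (\<lambda>x. partial_deriv i f x + partial_deriv i g x)"
      using Suc \<open>i < n\<close> by simp
    ultimately show ?thesis
      by (subst Ck_on_cong[OF assms(1)]) auto
  qed
  then show ?case
    using Suc.prems by (auto intro: continuous_map_add)
qed

lemma Ck_on_mult:
  assumes "openin (Euclidean_space n) U" "Ck_on k n U f" "Ck_on k n U g"
  shows "Ck_on k n U (\<lambda>x. f x * g x)"
  using assms(2,3)
proof (induction k arbitrary: f g)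
  case 0
  then show ?case by (simp add: continuous_map_real_mult)
next
  case (Suc k)
  have "Ck_on k n U (partial_deriv i (\<lambda>x. f x * g x))" if "i < n" for i
  proof -
    have "partial_deriv i (\<lambda>x. f x * g x) x = f x * partial_deriv i g x + partial_deriv i f x * g x"
      if "x \<in> U" for x
    proof -
      have "DERIV (\<lambda>t. f (x(i := t)) * g (x(i := t))) (x i) :>
            f (x(i := x i)) * partial_deriv i g x + partial_deriv i f x * g (x(i := x i))"
        using that \<open>i < n\<close> Suc.prems
        by (intro DERIV_mult' partial_deriv_has_deriv) auto
      then show ?thesis
        unfolding partial_deriv_def[of i "\<lambda>x. f x * g x"] by (simp add: DERIV_imp_deriv)
    qed
    \<comment> \<open>The factors f and g themselves occur here, so their regularity is first
      lowered from \<open>Suc k\<close> to \<open>k\<close>.\<close>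
    moreover have "Ck_on k n U (\<lambda>x. f x * partial_deriv i g x + partial_deriv i f x * g x)"
      using Suc.prems[THEN Ck_on_SucD] Suc.prems \<open>i < n\<close>
      by (intro Ck_on_add[OF assms(1)] Suc.IH) auto
    ultimately show ?thesis
      by (subst Ck_on_cong[OF assms(1)]) auto
  qed
  then show ?case
    using Suc.prems by (auto intro: continuous_map_real_mult)
qed

lemma Ck_on_const: "Ck_on k n U (\<lambda>x. c)"
proof (induction k arbitrary: c)
  case (Suc k)
  have "partial_deriv i (\<lambda>x. c) = (\<lambda>x. 0)" for i
    by (auto simp: partial_deriv_def)
  with Suc show ?case by simp
qed simp

context
  fixes M :: "'a mfd"
  assumes mfd: "smooth_manifold M"
begin

lemma openin_chart_image: "(U, \<phi>) \<in> charts M \<Longrightarrow> openin (Euclidean_space (mdim M)) (\<phi> ` U)"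
  using mfd unfolding smooth_manifold_def by blast

lemma smooth_add: "f \<in> smooth_functions M \<Longrightarrow> g \<in> smooth_functions M \<Longrightarrow> f + g \<in> smooth_functions M"
  using openin_chart_image unfolding smooth_functions_def smooth_on_def plus_fun_def
  by (fast intro: Ck_on_add)

lemma smooth_mult: "f \<in> smooth_functions M \<Longrightarrow> g \<in> smooth_functions M \<Longrightarrow> f * g \<in> smooth_functions M"
  using openin_chart_image unfolding smooth_functions_def smooth_on_def times_fun_def
  by (fast intro: Ck_on_mult)

lemma smooth_const: "(\<lambda>_. c) \<in> smooth_functions M"
  unfolding smooth_functions_def smooth_on_def by (auto intro: Ck_on_const)

lemma smooth_cmult: "f \<in> smooth_functions M \<Longrightarrow> (\<lambda>q. c * f q) \<in> smooth_functions M"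
  using smooth_mult[OF smooth_const[of c], of f] by (simp add: times_fun_def)

lemma smooth_diff: "f \<in> smooth_functions M \<Longrightarrow> g \<in> smooth_functions M \<Longrightarrow> f - g \<in> smooth_functions M"
  using smooth_add[OF _ smooth_cmult[of g "-1"], of f] by (simp add: plus_fun_def fun_diff_def)

section \<open>The Lie algebra of vector fields\<close>

lemma tangent_add: "v \<in> tangent_space M p \<Longrightarrow> w \<in> tangent_space M p \<Longrightarrow> v + w \<in> tangent_space M p"
  by (auto simp: tangent_space_def algebra_simps)

lemma tangent_scale: "v \<in> tangent_space M p \<Longrightarrow> tscale c v \<in> tangent_space M p"
  by (auto simp: tangent_space_def tscale_def algebra_simps)

lemma tangent_diff: "v \<in> tangent_space M p \<Longrightarrow> w \<in> tangent_space M p \<Longrightarrow> v - w \<in> tangent_space M p"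
  by (auto simp: tangent_space_def algebra_simps)

lemma vf_tangent: "X \<in> vector_fields M \<Longrightarrow> p \<in> points M \<Longrightarrow> X p \<in> tangent_space M p"
  and vf_smooth: "X \<in> vector_fields M \<Longrightarrow> f \<in> smooth_functions M \<Longrightarrow> (\<lambda>p. X p f) \<in> smooth_functions M"
  and vf_outside: "X \<in> vector_fields M \<Longrightarrow> p \<notin> points M \<Longrightarrow> X p = 0"
  by (auto simp: vector_fields_def)

lemma vf_add: "X \<in> vector_fields M \<Longrightarrow> Y \<in> vector_fields M \<Longrightarrow> X + Y \<in> vector_fields M"
  using smooth_add[of "\<lambda>p. X p f" "\<lambda>p. Y p f" for f, unfolded plus_fun_def[of "\<lambda>p. X p f" for f]]
  by (auto simp: vector_fields_def tangent_add)

lemma vf_diff: "X \<in> vector_fields M \<Longrightarrow> Y \<in> vector_fields M \<Longrightarrow> X - Y \<in> vector_fields M"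
  using smooth_diff[of "\<lambda>p. X p f" "\<lambda>p. Y p f" for f] tangent_diff
  by (auto simp: vector_fields_def fun_diff_def)

lemma vf_fscale: "f \<in> smooth_functions M \<Longrightarrow> X \<in> vector_fields M \<Longrightarrow> fscale f X \<in> vector_fields M"
  using smooth_mult[of f "\<lambda>p. X p g" for g] tangent_scale
  by (auto simp: vector_fields_def fscale_def tscale_def times_fun_def zero_fun_def)

text \<open>This rule and the next three hold at every p, because a field is 0 off the manifold; the
  bracket computation then needs no case split.\<close>

lemma vf_apply_add:
  assumes "X \<in> vector_fields M" "f \<in> smooth_functions M" "g \<in> smooth_functions M"
  shows "X p (f + g) = X p f + X p g"
  using assms by (cases "p \<in> points M") (auto simp: vector_fields_def tangent_space_def)

lemma vf_apply_mult:
  assumes "X \<in> vector_fields M" "f \<in> smooth_functions M" "g \<in> smooth_functions M"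
  shows "X p (f * g) = f p * X p g + g p * X p f"
  using assms by (cases "p \<in> points M") (auto simp: vector_fields_def tangent_space_def)

lemma vf_apply_cmult:
  assumes "X \<in> vector_fields M" "f \<in> smooth_functions M"
  shows "X p (\<lambda>q. c * f q) = c * X p f"
  using assms by (cases "p \<in> points M") (auto simp: vector_fields_def tangent_space_def)

lemma vf_apply_nonsmooth:
  assumes "X \<in> vector_fields M" "f \<notin> smooth_functions M"
  shows "X p f = 0"
  using assms by (cases "p \<in> points M") (auto simp: vector_fields_def tangent_space_def)

text \<open>The commutator of two derivations is a derivation: the mixed products of first
  derivatives are symmetric in X and Y and cancel.\<close>

lemma vf_lie_bracket:
  assumes X: "X \<in> vector_fields M" and Y: "Y \<in> vector_fields M"
  shows "lie_bracket X Y \<in> vector_fields M"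
proof -
  have add: "lie_bracket X Y p (f + g) = lie_bracket X Y p f + lie_bracket X Y p g"
    if f: "f \<in> smooth_functions M" and g: "g \<in> smooth_functions M" for p f g
  proof -
    have "(\<lambda>q. Z q (f + g)) = (\<lambda>q. Z q f) + (\<lambda>q. Z q g)" if "Z \<in> vector_fields M" for Z
      using that f g by (auto simp: vf_apply_add)
    then show ?thesis
      using X Y f g by (simp add: lie_bracket_def vf_apply_add vf_smooth)
  qed
  have mult: "lie_bracket X Y p (f * g) = f p * lie_bracket X Y p g + g p * lie_bracket X Y p f"
    if f: "f \<in> smooth_functions M" and g: "g \<in> smooth_functions M" for p f g
  proof -
    have "(\<lambda>q. Z q (f * g)) = f * (\<lambda>q. Z q g) + g * (\<lambda>q. Z q f)" if "Z \<in> vector_fields M" for Z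
      using that f g by (auto simp: vf_apply_mult)
    then show ?thesis
      using X Y f g
      by (simp add: lie_bracket_def vf_apply_add vf_apply_mult vf_smooth smooth_mult algebra_simps)
  qed
  have cmult: "lie_bracket X Y p (\<lambda>q. c * f q) = c * lie_bracket X Y p f"
    if f: "f \<in> smooth_functions M" for p f c
    by (simp add: lie_bracket_def right_diff_distrib vf_apply_cmult[OF X f] vf_apply_cmult[OF Y f]
      vf_apply_cmult[OF X vf_smooth[OF Y f]] vf_apply_cmult[OF Y vf_smooth[OF X f]])
  \<comment> \<open>For non-smooth f the inner functions are constantly 0, and homogeneity with
    factor 0 shows that a field kills the zero function.\<close>
  have nonsmooth: "lie_bracket X Y p f = 0" if "f \<notin> smooth_functions M" for p f
    using vf_apply_cmult[OF X smooth_const[of 0], of p 0] vf_apply_cmult[OF Y smooth_const[of 0], of p 0]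
    by (simp add: lie_bracket_def vf_apply_nonsmooth[OF X that] vf_apply_nonsmooth[OF Y that])
  have smooth: "(\<lambda>p. lie_bracket X Y p f) \<in> smooth_functions M" if "f \<in> smooth_functions M" for f
    using smooth_diff[OF vf_smooth[OF X vf_smooth[OF Y that]] vf_smooth[OF Y vf_smooth[OF X that]]]
    by (simp add: lie_bracket_def fun_diff_def)
  have outside: "lie_bracket X Y p = 0" if "p \<notin> points M" for p
    using vf_outside[OF X that] vf_outside[OF Y that] by (auto simp: lie_bracket_def)
  show ?thesis
    using add mult cmult nonsmooth smooth outside
    by (auto simp: vector_fields_def tangent_space_def)
qed

end

text \<open>Recorded beside antisymmetry because the abstract setting is an abelian group, where
  antisymmetry only gives that twice the bracket is 0.\<close>

lemma lie_bracket_self: "lie_bracket X X = 0"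
  by (simp add: lie_bracket_def fun_eq_iff)

lemma lie_bracket_swap: "lie_bracket Y X = - lie_bracket X Y"
  by (simp add: lie_bracket_def fun_eq_iff)

section \<open>Compatible torsion-free connections on a commutative algebra\<close>

text \<open>A carrier set is used since the ring laws concern genuine vector fields only. The locale
  serves both multiplications on the same carrier.\<close>

locale comm_algebra_on =
  fixes V :: "'v::ab_group_add set" and mul :: "'v \<Rightarrow> 'v \<Rightarrow> 'v" (infixl "\<cdot>" 70) and e :: 'v
  assumes add_closed [simp]: "x \<in> V \<Longrightarrow> y \<in> V \<Longrightarrow> x + y \<in> V"
    and diff_closed [simp]: "x \<in> V \<Longrightarrow> y \<in> V \<Longrightarrow> x - y \<in> V"
    and mul_closed [simp]: "x \<in> V \<Longrightarrow> y \<in> V \<Longrightarrow> x \<cdot> y \<in> V"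
    and unit_closed [simp]: "e \<in> V"
    and mul_comm: "x \<in> V \<Longrightarrow> y \<in> V \<Longrightarrow> x \<cdot> y = y \<cdot> x"
    and mul_assoc: "x \<in> V \<Longrightarrow> y \<in> V \<Longrightarrow> z \<in> V \<Longrightarrow> (x \<cdot> y) \<cdot> z = x \<cdot> (y \<cdot> z)"
    and mul_add: "x \<in> V \<Longrightarrow> y \<in> V \<Longrightarrow> z \<in> V \<Longrightarrow> x \<cdot> (y + z) = x \<cdot> y + x \<cdot> z"
    and mul_unit [simp]: "x \<in> V \<Longrightarrow> x \<cdot> e = x"
begin

lemma unit_mul [simp]: "x \<in> V \<Longrightarrow> e \<cdot> x = x"
  using mul_comm[of e x] by simp

lemma mul_left_comm: "x \<in> V \<Longrightarrow> y \<in> V \<Longrightarrow> z \<in> V \<Longrightarrow> x \<cdot> (y \<cdot> z) = y \<cdot> (x \<cdot> z)"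
  by (metis mul_assoc mul_comm)

lemmas mul_ac = mul_comm mul_assoc mul_left_comm

lemma add_mul: "x \<in> V \<Longrightarrow> y \<in> V \<Longrightarrow> z \<in> V \<Longrightarrow> (y + z) \<cdot> x = y \<cdot> x + z \<cdot> x"
  using mul_add[of x y z] by (simp add: mul_comm)

lemma mul_diff: "x \<in> V \<Longrightarrow> y \<in> V \<Longrightarrow> z \<in> V \<Longrightarrow> x \<cdot> (y - z) = x \<cdot> y - x \<cdot> z"
  using mul_add[of x "y - z" z] by simp

lemma diff_mul: "x \<in> V \<Longrightarrow> y \<in> V \<Longrightarrow> z \<in> V \<Longrightarrow> (y - z) \<cdot> x = y \<cdot> x - z \<cdot> x"
  using add_mul[of x "y - z" z] by simp

lemma zero_closed [simp]: "0 \<in> V"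
  using diff_closed[of e e] by simp

lemma minus_closed [simp]: "x \<in> V \<Longrightarrow> - x \<in> V"
  using diff_closed[of 0 x] by simp

lemma mul_zero [simp]: "x \<in> V \<Longrightarrow> x \<cdot> 0 = 0"
  using mul_diff[of x e e] by simp

lemma mul_minus: "x \<in> V \<Longrightarrow> y \<in> V \<Longrightarrow> x \<cdot> (- y) = - (x \<cdot> y)"
  using mul_diff[of x 0 y] by simp

lemma minus_mul: "x \<in> V \<Longrightarrow> y \<in> V \<Longrightarrow> (- y) \<cdot> x = - (y \<cdot> x)"
  using mul_minus[of x y] by (simp add: mul_comm)

lemmas mul_distribs = mul_add add_mul mul_diff diff_mul mul_minus minus_mul

lemma inverse_unique:
  assumes "E \<in> V" "Z \<in> V" "Z' \<in> V" "E \<cdot> Z = e" "E \<cdot> Z' = e"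
  shows "Z = Z'"
proof -
  have "Z = Z \<cdot> (E \<cdot> Z')" using assms by simp
  also have "\<dots> = Z' \<cdot> (E \<cdot> Z)" using assms(1-3) by (simp add: mul_ac)
  finally show ?thesis using assms by simp
qed

end

text \<open>
  The bracket assumption is the David--Strachan characterisation
  \<open>L\<^sub>E(\<circ>)(X, Y) = [e, E] \<circ> X \<circ> Y\<close> of eventual identities; \<open>F\<close> is the inverse of \<open>E\<close>.
\<close>

locale eventual_identity_on = comm_algebra_on V mul e
  for V :: "'v::ab_group_add set" and mul (infixl "\<cdot>" 70) and e +
  fixes E F :: 'v and br :: "'v \<Rightarrow> 'v \<Rightarrow> 'v"
  assumes E_closed [simp]: "E \<in> V" and F_closed [simp]: "F \<in> V"
    and E_F [simp]: "E \<cdot> F = e"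
    and br_closed [simp]: "x \<in> V \<Longrightarrow> y \<in> V \<Longrightarrow> br x y \<in> V"
    and br_swap: "br y x = - br x y"
    and br_self: "br x x = 0"
    and br_E_mul: "x \<in> V \<Longrightarrow> y \<in> V \<Longrightarrow>
      br E (x \<cdot> y) = br E x \<cdot> y + x \<cdot> br E y + br e E \<cdot> (x \<cdot> y)"
begin

lemma F_E [simp]: "F \<cdot> E = e"
  using mul_comm[of F E] by simp

lemma E_F_mul [simp]: "x \<in> V \<Longrightarrow> E \<cdot> (F \<cdot> x) = x"
  by (simp add: mul_assoc[symmetric])

lemma F_E_mul [simp]: "x \<in> V \<Longrightarrow> F \<cdot> (E \<cdot> x) = x"
  by (simp add: mul_assoc[symmetric])

text \<open>Apply \<open>br_E_mul\<close> to \<open>E \<cdot> F = e\<close>: the term with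
  \<open>br E E\<close> vanishes, which leaves \<open>E \<cdot> br E F\<close> as minus twice
  \<open>br e E\<close>. The factor 2 appears as a sum because the ring carries no scalars.\<close>

lemma br_F_E: "br F E = F \<cdot> br e E + F \<cdot> br e E"
proof -
  have "br E e = br E E \<cdot> F + E \<cdot> br E F + br e E"
    using br_E_mul[of E F] by simp
  then have "E \<cdot> br E F = - br e E - br e E"
    by (simp add: br_self mul_comm[of 0] br_swap[of E e] algebra_simps)
  then have "F \<cdot> (E \<cdot> br E F) = F \<cdot> (- br e E - br e E)"
    by simp
  then show ?thesis
    by (simp add: mul_distribs br_swap[of F E])
qed

end

text \<open>Of total symmetry only the exchange of the first two arguments is assumed; the other
  exchange is commutativity. \<open>D_unit\<close> is the condition on the connection, rewritten by
  \<open>br_F_E\<close>.\<close>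

locale compatible_connection_on = eventual_identity_on V mul e E F br
  for V :: "'v::ab_group_add set" and mul (infixl "\<cdot>" 70) and e E F br +
  fixes D :: "'v \<Rightarrow> 'v \<Rightarrow> 'v"
  assumes D_closed [simp]: "x \<in> V \<Longrightarrow> y \<in> V \<Longrightarrow> D x y \<in> V"
    and torsion: "x \<in> V \<Longrightarrow> y \<in> V \<Longrightarrow> D x y - D y x = br x y"
    and compat1: "x \<in> V \<Longrightarrow> y \<in> V \<Longrightarrow> z \<in> V \<Longrightarrow>
      D x (y \<cdot> z) - D x y \<cdot> z - y \<cdot> D x z = D y (x \<cdot> z) - D y x \<cdot> z - x \<cdot> D y z"
    and D_unit: "x \<in> V \<Longrightarrow> D x e = F \<cdot> br e E \<cdot> x"
begin

definition S :: "'v \<Rightarrow> 'v \<Rightarrow> 'v \<Rightarrow> 'v" where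
  "S x y z = D x (y \<cdot> z) - D x y \<cdot> z - y \<cdot> D x z"

lemma S_closed [simp]: "x \<in> V \<Longrightarrow> y \<in> V \<Longrightarrow> z \<in> V \<Longrightarrow> S x y z \<in> V"
  by (simp add: S_def)

lemma S_swap1: "x \<in> V \<Longrightarrow> y \<in> V \<Longrightarrow> z \<in> V \<Longrightarrow> S x y z = S y x z"
  unfolding S_def by (rule compat1)

lemma S_swap2: "x \<in> V \<Longrightarrow> y \<in> V \<Longrightarrow> z \<in> V \<Longrightarrow> S x y z = S x z y"
  unfolding S_def by (simp add: mul_ac)

lemma D_mul: "x \<in> V \<Longrightarrow> y \<in> V \<Longrightarrow> z \<in> V \<Longrightarrow> D x (y \<cdot> z) = S x y z + D x y \<cdot> z + y \<cdot> D x z"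
  by (simp add: S_def)

text \<open>Differentiate \<open>E \<cdot> F = e\<close>: \<open>D_mul\<close> expands the product
  and \<open>D_unit\<close> gives the derivative of e. Symmetry of S brings the tensor term into the
  form that occurs in \<open>D_F_mul_E\<close>.\<close>

lemma E_D_F:
  assumes "x \<in> V"
  shows "E \<cdot> D x F = F \<cdot> br e E \<cdot> x - F \<cdot> D x E - S E F x"
proof -
  have "S E F x = S x E F"
    using assms S_swap1[of x E F] S_swap2[of E x F] by simp
  moreover have "F \<cdot> br e E \<cdot> x = S x E F + D x E \<cdot> F + E \<cdot> D x F"
    using D_mul[of x E F] D_unit assms by simp
  ultimately show ?thesis
    using assms by (simp add: mul_comm[of F "D x E"] algebra_simps)
qed

text \<open>Torsion exchanges direction and argument, so that \<open>D E\<close> and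
  \<open>br E\<close> can both be expanded on the product of F and x. Torsion then recombines the
  pieces into \<open>D x E\<close> and \<open>D F E\<close>.\<close>

lemma D_F_mul_E:
  assumes "x \<in> V"
  shows "D (F \<cdot> x) E = S E F x + F \<cdot> D x E + (D F E - F \<cdot> br e E) \<cdot> x"
proof -
  have 1: "D (F \<cdot> x) E = D E (F \<cdot> x) - br E (F \<cdot> x)"
    and 2: "br E x = D E x - D x E" and 3: "br E F = D E F - D F E"
    using torsion[of E "F \<cdot> x"] torsion[of E x] torsion[of E F] assms by (simp_all add: algebra_simps)
  show ?thesis
    unfolding 1 using assms
    by (simp add: D_mul[of E F x] br_E_mul 2 3 mul_distribs mul_ac)
qed

section \<open>The second structure connection in the algebra\<close>

definition D_dual :: "'v \<Rightarrow> 'v \<Rightarrow> 'v" where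
  "D_dual x y = E \<cdot> D x (F \<cdot> y) - D (F \<cdot> y) E \<cdot> x"

lemma D_dual_closed [simp]: "x \<in> V \<Longrightarrow> y \<in> V \<Longrightarrow> D_dual x y \<in> V"
  by (simp add: D_dual_def)

text \<open>Once derivatives of F are eliminated by \<open>E_D_F\<close>, \<open>D_dual x y\<close>
  is \<open>D x y\<close> plus terms whose sum is symmetric in x and y. Both connections thus have
  the same antisymmetric part.\<close>

lemma torsion_dual:
  assumes [simp]: "x \<in> V" "y \<in> V"
  shows "D_dual x y - D_dual y x = br x y"
proof -
  have "D_dual x y = E \<cdot> S F x y + D x y + F \<cdot> br e E \<cdot> x \<cdot> y - F \<cdot> D x E \<cdot> y - S E F x \<cdot> y
         - S E F y \<cdot> x - F \<cdot> D y E \<cdot> x - (D F E - F \<cdot> br e E) \<cdot> y \<cdot> x"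
    if [simp]: "x \<in> V" "y \<in> V" for x y
  proof -
    have "E \<cdot> (D x F \<cdot> y) = (F \<cdot> br e E \<cdot> x - F \<cdot> D x E - S E F x) \<cdot> y"
      by (simp only: E_D_F[OF that(1), symmetric]) (simp add: mul_assoc)
    then show ?thesis
      unfolding D_dual_def
      by (simp add: D_mul[of x F y] D_F_mul_E S_swap1[of x F] mul_distribs mul_assoc)
  qed
  from this[of x y] this[of y x] torsion[of x y, symmetric] S_swap2[of F x y]
  show ?thesis
    by (simp add: mul_distribs mul_ac)
qed

text \<open>The left side is the covariant derivative of the dual multiplication under
  \<open>D_dual\<close>. In terms of \<open>F \<cdot> y\<close> and \<open>F \<cdot> z\<close> it
  splits into a tensor S in direction x and the Leibniz defect of \<open>D _ E\<close>. Torsion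
  turns that defect into S in direction E minus the defect of \<open>br E\<close>, which
  \<open>br_E_mul\<close> provides.\<close>

lemma S_dual:
  assumes [simp]: "x \<in> V" "y \<in> V" "z \<in> V"
  shows "D_dual x (y \<cdot> z \<cdot> F) - D_dual x y \<cdot> z \<cdot> F - y \<cdot> D_dual x z \<cdot> F =
    E \<cdot> S x (F \<cdot> y) (F \<cdot> z) - x \<cdot> S E (F \<cdot> y) (F \<cdot> z) + br e E \<cdot> (x \<cdot> ((F \<cdot> y) \<cdot> (F \<cdot> z)))"
proof -
  define u v where "u = F \<cdot> y" and "v = F \<cdot> z"
  have [simp]: "u \<in> V" "v \<in> V" by (simp_all add: u_def v_def)
  have zF: "w \<cdot> z \<cdot> F = w \<cdot> v" if "w \<in> V" for w
    using that by (simp add: mul_assoc v_def mul_comm[of z F])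
  have yF: "y \<cdot> w \<cdot> F = u \<cdot> w" if "w \<in> V" for w
    using that mul_comm[of "y \<cdot> w" F] by (simp add: mul_assoc u_def)
  have yz: "F \<cdot> (y \<cdot> v) = u \<cdot> v"
    by (simp add: mul_assoc u_def)
  have D: "D_dual x y = E \<cdot> D x u - D u E \<cdot> x" "D_dual x z = E \<cdot> D x v - D v E \<cdot> x"
    "D_dual x (y \<cdot> v) = E \<cdot> D x (u \<cdot> v) - D (u \<cdot> v) E \<cdot> x"
    unfolding D_dual_def yz by (simp_all add: u_def v_def)
  have tor: "D w E = D E w - br E w" if "w \<in> V" for w
    using torsion[of E w] that by (simp add: algebra_simps)
  have "D_dual x (y \<cdot> z \<cdot> F) - D_dual x y \<cdot> z \<cdot> F - y \<cdot> D_dual x z \<cdot> F =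
     D_dual x (y \<cdot> v) - D_dual x y \<cdot> v - u \<cdot> D_dual x z"
    by (simp only: zF yF assms D_dual_closed)
  also have "\<dots> =
     E \<cdot> (D x (u \<cdot> v) - D x u \<cdot> v - u \<cdot> D x v) - x \<cdot> (D (u \<cdot> v) E - D u E \<cdot> v - u \<cdot> D v E)"
    unfolding D by (simp add: mul_distribs mul_ac)
  also have "D (u \<cdot> v) E - D u E \<cdot> v - u \<cdot> D v E = S E u v - br e E \<cdot> (u \<cdot> v)"
    by (simp add: tor br_E_mul S_def mul_distribs)
  finally show ?thesis
    by (simp add: mul_distribs flip: S_def u_def v_def) (simp add: mul_ac)
qed

text \<open>In \<open>S_dual\<close> the bracket term is visibly symmetric in x and y. For the two S
  terms, writing x and y as multiples of E lets a common factor E be taken out.\<close>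

lemma compat_dual:
  assumes [simp]: "x \<in> V" "y \<in> V" "z \<in> V"
  shows "D_dual x (y \<cdot> z \<cdot> F) - D_dual x y \<cdot> z \<cdot> F - y \<cdot> D_dual x z \<cdot> F =
         D_dual y (x \<cdot> z \<cdot> F) - D_dual y x \<cdot> z \<cdot> F - x \<cdot> D_dual y z \<cdot> F"
proof -
  define u v w where "u = F \<cdot> x" and "v = F \<cdot> y" and "w = F \<cdot> z"
  have [simp]: "u \<in> V" "v \<in> V" "w \<in> V" by (simp_all add: u_def v_def w_def)
  have x: "x = E \<cdot> u" and y: "y = E \<cdot> v" by (simp_all add: u_def v_def)
  have S: "S (E \<cdot> a) b w = S w (E \<cdot> a) b" if "a \<in> V" "b \<in> V" for a b
    using that S_swap1[of w "E \<cdot> a" b] S_swap2[of "E \<cdot> a" w b] by simp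
  have S_E: "S E a w = S w E a" if "a \<in> V" for a
    using that S[of e a] by simp
  \<comment> \<open>With w moved into the direction slot, the left side unfolds to \<open>D w (E
    \<cdot> u \<cdot> v) - D w (E \<cdot> u) \<cdot> v - u \<cdot> D w (E \<cdot> v) + u \<cdot> v
    \<cdot> D w E\<close>, symmetric in u and v. This is the Hochschild cocycle identity of
    \<open>S w\<close>.\<close>
  have "S (E \<cdot> u) v w - u \<cdot> S E v w = S (E \<cdot> v) u w - v \<cdot> S E u w"
    unfolding S[of u v, simplified] S[of v u, simplified] S_E[of u, simplified] S_E[of v, simplified]
    by (simp add: S_def mul_distribs mul_ac)
  then have "E \<cdot> (S x v w - u \<cdot> S E v w) = E \<cdot> (S y u w - v \<cdot> S E u w)"
    unfolding x y by simp
  then have "E \<cdot> S x v w - x \<cdot> S E v w = E \<cdot> S y u w - y \<cdot> S E u w"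
    by (simp add: mul_distribs x y mul_assoc)
  moreover have "x \<cdot> (v \<cdot> w) = y \<cdot> (u \<cdot> w)"
    by (simp add: x y mul_ac)
  ultimately show ?thesis
    by (simp add: S_dual flip: u_def v_def w_def)
qed

text \<open>The condition on the unit for the dual structure, whose unit is E. The first term of
  \<open>D_dual\<close> contributes \<open>br e E\<close> once, while \<open>D e E\<close> is twice
  \<open>br e E\<close>, so the sign flips.\<close>

lemma D_dual_E:
  assumes [simp]: "x \<in> V"
  shows "D_dual x E = br E e \<cdot> x"
proof -
  have "D e E = br e E + F \<cdot> br e E \<cdot> E"
    using torsion[of e E] D_unit[of E] by (simp add: algebra_simps)
  also have "F \<cdot> br e E \<cdot> E = br e E"
    by (simp add: mul_assoc mul_comm[of _ E])
  finally show ?thesis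
    by (simp add: D_dual_def D_unit br_swap[of E e] mul_assoc mul_distribs)
qed

text \<open>The left side is the second structure connection of the dual data: the dual inverse of e
  times y is \<open>E \<cdot> y\<close>, and a dual product with e is multiplication by F.\<close>

lemma D_dual_dual:
  assumes [simp]: "x \<in> V" "y \<in> V"
  shows "F \<cdot> D_dual x (E \<cdot> y) - D_dual (E \<cdot> y) e \<cdot> x \<cdot> F = D x y"
proof -
  \<comment> \<open>Adding the two formulas at \<open>E \<cdot> y\<close> cancels the S terms, the
    derivatives \<open>D (E \<cdot> y) E\<close> and the brackets.\<close>
  have "D y E + E \<cdot> D (E \<cdot> y) F = E \<cdot> (D F E \<cdot> y)"
    using E_D_F[of "E \<cdot> y"] D_F_mul_E[of "E \<cdot> y"] by (simp add: mul_distribs mul_ac)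
  then have "F \<cdot> (x \<cdot> (D y E + E \<cdot> D (E \<cdot> y) F)) = F \<cdot> (x \<cdot> (E \<cdot> (D F E \<cdot> y)))"
    by simp
  then show ?thesis
    by (simp add: D_dual_def mul_distribs mul_ac algebra_simps)
qed

end

section \<open>Duality of F-manifolds with eventual identities\<close>

lemma tangent_mult_assoc:
  assumes "comm_assoc_mult M m" "p \<in> points M"
    and "u \<in> tangent_space M p" "v \<in> tangent_space M p" "w \<in> tangent_space M p"
  shows "m p (m p u v) w = m p u (m p v w)"
  using assms(1)[unfolded comm_assoc_mult_def, THEN conjunct1, THEN bspec, OF assms(2),
      THEN bspec, OF assms(3), THEN bspec, OF assms(4), THEN conjunct2, THEN conjunct2,
      THEN conjunct2, THEN conjunct2, THEN bspec, OF assms(5)]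
  by (elim conjE)

text \<open>The fibrewise laws become equalities of fields on the whole type, since fields and
  products are normalised to 0 off the manifold.\<close>

lemma F_manifold_comm_algebra:
  assumes "F_manifold M m e"
  shows "comm_algebra_on (vector_fields M) (\<lambda>X Y. X \<odot>\<^bsub>m\<^esub> Y) e"
proof -
  have mfd: "smooth_manifold M" and cam: "comm_assoc_mult M m" and unit: "unit_field M m e"
    using assms by (auto simp: F_manifold_def)
  note tangent = vf_tangent[OF mfd] and outside = vf_outside[OF mfd]
  have m_outside: "m p u v = 0" if "p \<notin> points M" for p u v
    using cam that by (auto simp: comm_assoc_mult_def)
  show ?thesis
  proof
    fix X Y assume XY: "X \<in> vector_fields M" "Y \<in> vector_fields M"
    show "X + Y \<in> vector_fields M" "X - Y \<in> vector_fields M"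
      using XY by (simp_all add: vf_add[OF mfd] vf_diff[OF mfd])
    show "X \<odot>\<^bsub>m\<^esub> Y \<in> vector_fields M"
      using XY cam by (auto simp: comm_assoc_mult_def)
    show "X \<odot>\<^bsub>m\<^esub> Y = Y \<odot>\<^bsub>m\<^esub> X"
    proof
      fix p show "(X \<odot>\<^bsub>m\<^esub> Y) p = (Y \<odot>\<^bsub>m\<^esub> X) p"
        using XY[THEN tangent, of p] cam m_outside[of p]
        by (cases "p \<in> points M") (auto simp: vmult_def comm_assoc_mult_def)
    qed
    show "X \<odot>\<^bsub>m\<^esub> e = X"
    proof
      fix p show "(X \<odot>\<^bsub>m\<^esub> e) p = X p"
        using XY(1)[THEN tangent, of p] unit outside[OF XY(1), of p] m_outside[of p]
        by (cases "p \<in> points M") (auto simp: vmult_def unit_field_def)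
    qed
    fix Z assume Z: "Z \<in> vector_fields M"
    show "(X \<odot>\<^bsub>m\<^esub> Y) \<odot>\<^bsub>m\<^esub> Z = X \<odot>\<^bsub>m\<^esub> (Y \<odot>\<^bsub>m\<^esub> Z)"
    proof
      fix p show "((X \<odot>\<^bsub>m\<^esub> Y) \<odot>\<^bsub>m\<^esub> Z) p = (X \<odot>\<^bsub>m\<^esub> (Y \<odot>\<^bsub>m\<^esub> Z)) p"
        using XY[THEN tangent, of p] Z[THEN tangent, of p] m_outside[of p]
        by (cases "p \<in> points M") (simp_all add: vmult_def tangent_mult_assoc[OF cam])
    qed
    show "X \<odot>\<^bsub>m\<^esub> (Y + Z) = X \<odot>\<^bsub>m\<^esub> Y + X \<odot>\<^bsub>m\<^esub> Z"
    proof
      fix p show "(X \<odot>\<^bsub>m\<^esub> (Y + Z)) p = (X \<odot>\<^bsub>m\<^esub> Y + X \<odot>\<^bsub>m\<^esub> Z) p"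
        using XY[THEN tangent, of p] Z[THEN tangent, of p] cam m_outside[of p]
        by (cases "p \<in> points M") (auto simp: vmult_def comm_assoc_mult_def)
    qed
  next
    show "e \<in> vector_fields M"
      using unit by (simp add: unit_field_def)
  qed
qed

lemma fscale_vmult:
  assumes "smooth_manifold M" "comm_assoc_mult M m" "X \<in> vector_fields M" "Y \<in> vector_fields M"
  shows "fscale f X \<odot>\<^bsub>m\<^esub> Y = fscale f (X \<odot>\<^bsub>m\<^esub> Y)" and "X \<odot>\<^bsub>m\<^esub> fscale f Y = fscale f (X \<odot>\<^bsub>m\<^esub> Y)"
proof -
  have "(fscale f X \<odot>\<^bsub>m\<^esub> Y) p = fscale f (X \<odot>\<^bsub>m\<^esub> Y) p \<and> (X \<odot>\<^bsub>m\<^esub> fscale f Y) p = fscale f (X \<odot>\<^bsub>m\<^esub> Y) p" for p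
    using assms(2) vf_tangent[OF assms(1,3), of p] vf_tangent[OF assms(1,4), of p]
    by (cases "p \<in> points M") (auto simp: vmult_def fscale_def tscale_def comm_assoc_mult_def)
  then show "fscale f X \<odot>\<^bsub>m\<^esub> Y = fscale f (X \<odot>\<^bsub>m\<^esub> Y)" "X \<odot>\<^bsub>m\<^esub> fscale f Y = fscale f (X \<odot>\<^bsub>m\<^esub> Y)"
    by auto
qed

lemma fscale_diff: "fscale f (X - Y) = fscale f X - fscale f Y"
  by (auto simp: fscale_def tscale_def fun_eq_iff right_diff_distrib)

lemma fscale_half_double: "fscale (\<lambda>_. 1/2) (X + X) = X"
  by (auto simp: fscale_def tscale_def fun_eq_iff)

text \<open>Putting e for both factors in the F-manifold identity says that the Lie derivative along
  e equals twice itself.\<close>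

lemma F_manifold_lie_deriv_unit:
  assumes F: "F_manifold M m e" and XY: "X \<in> vector_fields M" "Y \<in> vector_fields M"
  shows "lie_deriv_mult m e X Y = 0"
proof -
  interpret comm_algebra_on "vector_fields M" "\<lambda>X Y. X \<odot>\<^bsub>m\<^esub> Y" e
    by (rule F_manifold_comm_algebra[OF F])
  have mfd: "smooth_manifold M" using F by (simp add: F_manifold_def)
  have L: "lie_deriv_mult m e X Y \<in> vector_fields M"
    using XY by (simp add: lie_deriv_mult_def vf_lie_bracket[OF mfd])
  have "lie_deriv_mult m (e \<odot>\<^bsub>m\<^esub> e) X Y = e \<odot>\<^bsub>m\<^esub> lie_deriv_mult m e X Y + e \<odot>\<^bsub>m\<^esub> lie_deriv_mult m e X Y"
    using F XY unfolding F_manifold_def by (simp only: unit_closed)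
  with L show ?thesis by simp
qed

lemma dual_vmult: "X \<odot>\<^bsub>dual_mult M m e E\<^esub> Y = (X \<odot>\<^bsub>m\<^esub> Y) \<odot>\<^bsub>m\<^esub> field_inverse M m e E"
  by (simp add: vmult_def dual_mult_def)

lemma eventual_identity_on_fields:
  assumes F: "F_manifold M m e" and ev: "eventual_identity M m e E"
  shows "eventual_identity_on (vector_fields M) (\<lambda>X Y. X \<odot>\<^bsub>m\<^esub> Y) e E (field_inverse M m e E) lie_bracket"
proof -
  interpret comm_algebra_on "vector_fields M" "\<lambda>X Y. X \<odot>\<^bsub>m\<^esub> Y" e
    by (rule F_manifold_comm_algebra[OF F])
  have mfd: "smooth_manifold M" using F by (simp add: F_manifold_def)
  note [simp] = vf_lie_bracket[OF mfd]
  have E [simp]: "E \<in> vector_fields M" and dual: "F_manifold M (dual_mult M m e E) E"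
    using ev by (auto simp: eventual_identity_def invertible_field_def)
  define I where "I = field_inverse M m e E"
  have "\<exists>!Z. Z \<in> vector_fields M \<and> E \<odot>\<^bsub>m\<^esub> Z = e"
    using ev inverse_unique[OF E] unfolding eventual_identity_def invertible_field_def by metis
  from theI'[OF this] have I [simp]: "I \<in> vector_fields M" and EI: "E \<odot>\<^bsub>m\<^esub> I = e"
    by (auto simp: I_def field_inverse_def)
  have EI_mul [simp]: "(E \<odot>\<^bsub>m\<^esub> X) \<odot>\<^bsub>m\<^esub> I = X" if "X \<in> vector_fields M" for X
    using that mul_assoc[of X E I] by (simp add: EI mul_comm[of E X])
  have L: "lie_bracket E ((X \<odot>\<^bsub>m\<^esub> Y) \<odot>\<^bsub>m\<^esub> I) = (lie_bracket E X \<odot>\<^bsub>m\<^esub> Y) \<odot>\<^bsub>m\<^esub> I + (X \<odot>\<^bsub>m\<^esub> lie_bracket E Y) \<odot>\<^bsub>m\<^esub> I"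
    if "X \<in> vector_fields M" "Y \<in> vector_fields M" for X Y
    using F_manifold_lie_deriv_unit[OF dual that]
    by (simp add: lie_deriv_mult_def dual_vmult I_def algebra_simps)
  have br_mul: "lie_bracket E (X \<odot>\<^bsub>m\<^esub> Y) = lie_bracket E X \<odot>\<^bsub>m\<^esub> Y + X \<odot>\<^bsub>m\<^esub> lie_bracket E Y + lie_bracket e E \<odot>\<^bsub>m\<^esub> (X \<odot>\<^bsub>m\<^esub> Y)"
    if [simp]: "X \<in> vector_fields M" "Y \<in> vector_fields M" for X Y
  proof -
    have 1: "lie_bracket E Y = lie_bracket E e \<odot>\<^bsub>m\<^esub> Y + lie_bracket E (E \<odot>\<^bsub>m\<^esub> Y) \<odot>\<^bsub>m\<^esub> I"
      using L[of e "E \<odot>\<^bsub>m\<^esub> Y"] by (simp add: mul_assoc[of "lie_bracket E e"])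
    have 2: "lie_bracket E (X \<odot>\<^bsub>m\<^esub> Y) = lie_bracket E X \<odot>\<^bsub>m\<^esub> Y + X \<odot>\<^bsub>m\<^esub> (lie_bracket E (E \<odot>\<^bsub>m\<^esub> Y) \<odot>\<^bsub>m\<^esub> I)"
      using L[of X "E \<odot>\<^bsub>m\<^esub> Y"] by (simp add: mul_assoc[of X] mul_assoc[of "lie_bracket E X"])
    have 3: "lie_bracket E (E \<odot>\<^bsub>m\<^esub> Y) \<odot>\<^bsub>m\<^esub> I = lie_bracket E Y + lie_bracket e E \<odot>\<^bsub>m\<^esub> Y"
      using 1 by (simp add: lie_bracket_swap[of E e] minus_mul)
    show ?thesis
      unfolding 2 3 by (simp add: mul_distribs mul_ac)
  qed
  show ?thesis
    unfolding I_def[symmetric]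
    by unfold_locales
      (rule E I EI vf_lie_bracket[OF mfd] lie_bracket_swap lie_bracket_self br_mul | assumption)+
qed

section \<open>The dual F-manifold and its eventual identity\<close>

context
  fixes M :: "'a mfd" and m e E
  assumes F: "F_manifold M m e" and ev: "eventual_identity M m e E"
begin

interpretation eventual_identity_on "vector_fields M" "\<lambda>X Y. X \<odot>\<^bsub>m\<^esub> Y" e E "field_inverse M m e E" lie_bracket
  by (rule eventual_identity_on_fields[OF F ev])

lemma dual_F_manifold: "F_manifold M (dual_mult M m e E) E"
  using ev by (simp add: eventual_identity_def)

lemma dual_unit_mul_square: "e \<odot>\<^bsub>dual_mult M m e E\<^esub> (E \<odot>\<^bsub>m\<^esub> E) = E"
  by (simp add: dual_vmult mul_assoc)

lemma dual_inverse: "field_inverse M (dual_mult M m e E) E e = E \<odot>\<^bsub>m\<^esub> E"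
  using comm_algebra_on.inverse_unique[OF F_manifold_comm_algebra[OF dual_F_manifold], of e "E \<odot>\<^bsub>m\<^esub> E"]
    dual_unit_mul_square
  unfolding field_inverse_def by (intro the_equality) auto

text \<open>In the fibre, the two inverses of E cancel the square of E from
  \<open>dual_inverse\<close>. The equality concerns all arguments, not only values of fields, so
  the computation takes place in one tangent space.\<close>

lemma dual_dual_mult: "dual_mult M (dual_mult M m e E) E e = m"
proof -
  have cam: "comm_assoc_mult M m" and mfd: "smooth_manifold M" and unit: "unit_field M m e"
    using F by (auto simp: F_manifold_def)
  define I where "I = field_inverse M m e E"
  have "m p (m p (m p (m p v w) (I p)) (m p (E p) (E p))) (I p) = m p v w" for p v w
  proof (cases "p \<in> points M \<and> v \<in> tangent_space M p \<and> w \<in> tangent_space M p")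
    case True
    then have t: "E p \<in> tangent_space M p" "I p \<in> tangent_space M p"
        "m p v w \<in> tangent_space M p"
      using cam by (auto simp: I_def comm_assoc_mult_def intro!: vf_tangent[OF mfd])
    note a = cam[unfolded comm_assoc_mult_def, THEN conjunct1, rule_format, of p]
    have closed: "m p x y \<in> tangent_space M p" and comm: "m p x y = m p y x"
      if "x \<in> tangent_space M p" "y \<in> tangent_space M p" for x y
      using a[of x y] that True by auto
    have assoc: "m p (m p x y) z = m p x (m p y z)"
      if "x \<in> tangent_space M p" "y \<in> tangent_space M p" "z \<in> tangent_space M p" for x y z
      using tangent_mult_assoc[OF cam] that True by blast
    have EI: "m p (E p) (I p) = e p"
      using fun_cong[OF E_F, of p] by (simp add: vmult_def I_def)
    have IE: "m p (I p) (E p) = e p"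
      using EI comm[OF t(1,2)] by simp
    have e: "m p x (e p) = x" "m p (e p) x = x" if "x \<in> tangent_space M p" for x
      using unit that True by (auto simp: unit_field_def)
    have "m p (I p) (m p (m p (E p) (E p)) (I p)) = e p"
      using t by (simp add: assoc EI e IE closed)
    then show ?thesis
      using t by (simp add: assoc closed e)
  next
    case False
    then have "m p v w = 0"
      using cam by (auto simp: comm_assoc_mult_def)
    \<comment> \<open>Off the domain the innermost product is 0, and this must propagate outwards:
      by homogeneity with factor 0 on tangent vectors, by normalisation otherwise.\<close>
    moreover have "m p 0 x = 0" for x
    proof (cases "p \<in> points M \<and> x \<in> tangent_space M p \<and> 0 \<in> tangent_space M p")
      case True
      then have "m p (tscale 0 0) x = tscale 0 (m p 0 x)"
        using cam by (auto simp: comm_assoc_mult_def)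
      then show ?thesis
        by (simp add: tscale_def zero_fun_def)
    next
      case False
      then show ?thesis using cam by (auto simp: comm_assoc_mult_def)
    qed
    ultimately show ?thesis by simp
  qed
  then show ?thesis
    unfolding dual_mult_def[of M "dual_mult M m e E"] dual_inverse
    by (simp add: dual_mult_def vmult_def flip: I_def)
qed

text \<open>Dualising again returns \<open>m\<close>, so the F-manifold required is the original
  one; the square of E witnesses invertibility.\<close>

lemma dual_eventual_identity: "eventual_identity M (dual_mult M m e E) E e"
  unfolding eventual_identity_def invertible_field_def dual_dual_mult
  using F dual_unit_mul_square by auto

end

lemma second_structure_connection_eq:
  "X \<in> vector_fields M \<Longrightarrow> Y \<in> vector_fields M \<Longrightarrow> second_structure_connection M m e E D X Y =
    E \<odot>\<^bsub>m\<^esub> D X (field_inverse M m e E \<odot>\<^bsub>m\<^esub> Y) - D (field_inverse M m e E \<odot>\<^bsub>m\<^esub> Y) E \<odot>\<^bsub>m\<^esub> X"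
  by (simp add: second_structure_connection_def)

section \<open>Duality of the connections\<close>

context
  fixes M :: "'a mfd" and m e E D
  assumes special: "(M, m, e, E, D) \<in> special_F_manifolds"
begin

lemma special_F: "F_manifold M m e" and special_ev: "eventual_identity M m e E"
  and special_conn: "connection M D"
  using special by (auto simp: special_F_manifolds_def)

lemma special_mfd: "smooth_manifold M" and special_cam: "comm_assoc_mult M m"
  using special_F by (auto simp: F_manifold_def)

interpretation eventual_identity_on "vector_fields M" "\<lambda>X Y. X \<odot>\<^bsub>m\<^esub> Y" e E "field_inverse M m e E" lie_bracket
  by (rule eventual_identity_on_fields[OF special_F special_ev])

interpretation compatible_connection_on "vector_fields M" "\<lambda>X Y. X \<odot>\<^bsub>m\<^esub> Y" e E "field_inverse M m e E" lie_bracket D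
proof
  fix X Y Z assume XYZ: "X \<in> vector_fields M" "Y \<in> vector_fields M" "Z \<in> vector_fields M"
  show "D X Y \<in> vector_fields M"
    using special_conn XYZ by (simp add: connection_def)
  show "D X Y - D Y X = lie_bracket X Y"
    using special XYZ by (simp add: special_F_manifolds_def torsion_free_def)
  show "D X (Y \<odot>\<^bsub>m\<^esub> Z) - D X Y \<odot>\<^bsub>m\<^esub> Z - Y \<odot>\<^bsub>m\<^esub> D X Z = D Y (X \<odot>\<^bsub>m\<^esub> Z) - D Y X \<odot>\<^bsub>m\<^esub> Z - X \<odot>\<^bsub>m\<^esub> D Y Z"
    using special XYZ by (simp add: special_F_manifolds_def compatible_def cov_deriv_mult_def)
  show "D X e = (field_inverse M m e E \<odot>\<^bsub>m\<^esub> lie_bracket e E) \<odot>\<^bsub>m\<^esub> X"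
  proof -
    have "fscale (\<lambda>_. 1/2) (lie_bracket (field_inverse M m e E) E) = field_inverse M m e E \<odot>\<^bsub>m\<^esub> lie_bracket e E"
      by (simp only: br_F_E fscale_half_double)
    then show ?thesis
      using special XYZ by (simp add: special_F_manifolds_def)
  qed
qed

abbreviation (input) "m' \<equiv> dual_mult M m e E"
abbreviation (input) "D' \<equiv> second_structure_connection M m e E D"

lemma D'_eq: "X \<in> vector_fields M \<Longrightarrow> Y \<in> vector_fields M \<Longrightarrow> D' X Y = D_dual X Y"
  by (simp add: second_structure_connection_eq D_dual_def)

lemma dual_connection: "connection M D'"
proof -
  note fs = fscale_vmult[OF special_mfd special_cam]
  note [simp] = vf_fscale[OF special_mfd] vf_smooth[OF special_mfd]
  have D_add: "D (X + Y) Z = D X Z + D Y Z" "D Z (X + Y) = D Z X + D Z Y"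
    if "X \<in> vector_fields M" "Y \<in> vector_fields M" "Z \<in> vector_fields M" for X Y Z
    using special_conn that by (auto simp: connection_def)
  have D_fscale: "D (fscale f X) Y = fscale f (D X Y)"
      "D X (fscale f Y) = fscale (\<lambda>p. X p f) Y + fscale f (D X Y)"
    if "X \<in> vector_fields M" "Y \<in> vector_fields M" "f \<in> smooth_functions M" for X Y f
    using special_conn that by (auto simp: connection_def)
  show ?thesis
    unfolding connection_def
  proof (intro conjI ballI allI impI)
    fix X Y assume [simp]: "X \<in> vector_fields M" "Y \<in> vector_fields M"
    show "D' X Y \<in> vector_fields M"
      by (simp add: D'_eq)
    fix Z assume [simp]: "Z \<in> vector_fields M"
    show "D' (X + Y) Z = D' X Z + D' Y Z" "D' Z (X + Y) = D' Z X + D' Z Y"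
      by (simp_all add: D'_eq D_dual_def D_add mul_distribs)
  next
    fix X Y f assume [simp]: "X \<in> vector_fields M" "Y \<in> vector_fields M" "f \<in> smooth_functions M"
    show "D' (fscale f X) Y = fscale f (D' X Y)"
      by (simp add: D'_eq D_dual_def D_fscale fs fscale_diff)
    \<comment> \<open>The derivative of f multiplies \<open>E \<cdot> (F \<cdot> Y) = Y\<close>. In
      the second summand Y enters only as a direction, so it contributes no derivative of f.\<close>
    show "D' X (fscale f Y) = fscale (\<lambda>p. X p f) Y + fscale f (D' X Y)"
      by (simp add: D'_eq D_dual_def D_fscale fs fscale_diff mul_add)
  next
    fix X Y assume "X \<notin> vector_fields M \<or> Y \<notin> vector_fields M"
    then show "D' X Y = 0"
      by (auto simp: second_structure_connection_def)
  qed
qed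

lemma dual_special: "(M, m', E, e, D') \<in> special_F_manifolds"
proof -
  have "compatible M m' D'"
    unfolding compatible_def cov_deriv_mult_def dual_vmult
  proof (intro ballI conjI)
    fix X Y Z assume XYZ [simp]: "X \<in> vector_fields M" "Y \<in> vector_fields M" "Z \<in> vector_fields M"
    let ?I = "field_inverse M m e E"
    show "D' X ((Y \<odot>\<^bsub>m\<^esub> Z) \<odot>\<^bsub>m\<^esub> ?I) - (D' X Y \<odot>\<^bsub>m\<^esub> Z) \<odot>\<^bsub>m\<^esub> ?I - (Y \<odot>\<^bsub>m\<^esub> D' X Z) \<odot>\<^bsub>m\<^esub> ?I =
      D' Y ((X \<odot>\<^bsub>m\<^esub> Z) \<odot>\<^bsub>m\<^esub> ?I) - (D' Y X \<odot>\<^bsub>m\<^esub> Z) \<odot>\<^bsub>m\<^esub> ?I - (X \<odot>\<^bsub>m\<^esub> D' Y Z) \<odot>\<^bsub>m\<^esub> ?I"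
      by (simp only: D'_eq XYZ mul_closed F_closed compat_dual[of X Y Z])
    show "D' X ((Y \<odot>\<^bsub>m\<^esub> Z) \<odot>\<^bsub>m\<^esub> ?I) - (D' X Y \<odot>\<^bsub>m\<^esub> Z) \<odot>\<^bsub>m\<^esub> ?I - (Y \<odot>\<^bsub>m\<^esub> D' X Z) \<odot>\<^bsub>m\<^esub> ?I =
      D' X ((Z \<odot>\<^bsub>m\<^esub> Y) \<odot>\<^bsub>m\<^esub> ?I) - (D' X Z \<odot>\<^bsub>m\<^esub> Y) \<odot>\<^bsub>m\<^esub> ?I - (Z \<odot>\<^bsub>m\<^esub> D' X Y) \<odot>\<^bsub>m\<^esub> ?I"
      by (simp add: D'_eq mul_comm[of Z Y] mul_comm[of Y "D_dual X Z"] mul_comm[of Z "D_dual X Y"])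
  qed
  moreover have "torsion_free M D'"
    unfolding torsion_free_def by (simp add: D'_eq torsion_dual)
  moreover have "D' X E = fscale (\<lambda>_. 1/2) (lie_bracket (field_inverse M m' E e) e) \<odot>\<^bsub>m'\<^esub> X"
    if [simp]: "X \<in> vector_fields M" for X
  proof -
    \<comment> \<open>This is \<open>br_F_E\<close> for the dual structure, where E and e exchange
      roles; doubling again absorbs the factor one half.\<close>
    have "lie_bracket (field_inverse M m' E e) e =
        field_inverse M m' E e \<odot>\<^bsub>m'\<^esub> lie_bracket E e + field_inverse M m' E e \<odot>\<^bsub>m'\<^esub> lie_bracket E e"
      by (rule eventual_identity_on.br_F_E[OF eventual_identity_on_fields
            [OF dual_F_manifold[OF special_F special_ev] dual_eventual_identity[OF special_F special_ev]]])
    then have "fscale (\<lambda>_. 1/2) (lie_bracket (field_inverse M m' E e) e) = E \<odot>\<^bsub>m\<^esub> lie_bracket E e"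
      by (simp only: fscale_half_double) (simp add: dual_inverse[OF special_F special_ev] dual_vmult mul_comm[of _ "field_inverse M m e E"] mul_assoc)
    then show ?thesis
      by (simp add: D'_eq D_dual_E dual_vmult mul_comm[of _ "field_inverse M m e E"] mul_assoc)
  qed
  ultimately show ?thesis
    using dual_connection dual_F_manifold[OF special_F special_ev] dual_eventual_identity[OF special_F special_ev]
    by (simp add: special_F_manifolds_def)
qed

lemma dual_dual_connection: "second_structure_connection M m' E e D' = D"
proof (rule ext, rule ext)
  fix X Y
  show "second_structure_connection M m' E e D' X Y = D X Y"
  proof (cases "X \<in> vector_fields M \<and> Y \<in> vector_fields M")
    case True
    then have [simp]: "X \<in> vector_fields M" "Y \<in> vector_fields M" by auto
    have "field_inverse M m' E e \<odot>\<^bsub>m'\<^esub> Y = E \<odot>\<^bsub>m\<^esub> Y"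
      by (simp add: dual_inverse[OF special_F special_ev] dual_vmult mul_comm[of _ "field_inverse M m e E"] mul_assoc)
    then show ?thesis
      using D_dual_dual[of X Y]
      by (simp add: second_structure_connection_eq[of X M Y m' E e] dual_inverse[OF special_F special_ev] D'_eq)
        (simp add: dual_vmult mul_ac)
  next
    \<comment> \<open>Here both sides are 0 by the normalisation of connections.\<close>
    case False
    then show ?thesis
      using special_conn by (auto simp: second_structure_connection_def connection_def)
  qed
qed

end

theorem proposition23:
  shows "duality_map \<in> special_F_manifolds \<rightarrow> (special_F_manifolds :: 'a F_data set) \<and>
         (\<forall>x \<in> (special_F_manifolds :: 'a F_data set). duality_map (duality_map x) = x)"
proof (intro conjI Pi_I ballI)
  fix x :: "'a F_data" assume x: "x \<in> special_F_manifolds"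
  obtain M m e E D where [simp]: "x = (M, m, e, E, D)" by (cases x)
  show "duality_map x \<in> special_F_manifolds"
    using dual_special x by (simp add: duality_map_def)
  show "duality_map (duality_map x) = x"
    using x dual_dual_connection[of M m e E D] dual_dual_mult[OF special_F[of M m e E D] special_ev[of M m e E D]]
    by (simp add: duality_map_def)
qed

end
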